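(* Let $(S,\triangleright)$ and $(T,\triangleright)$ be left shelves, let $r_S$ and $r_T$ be the solutions associated with $(S,\triangleright)$ and $(T,\triangleright)$, respectively, i.e. $r_S(a,b)=(b,\,b\triangleright a)$ and $r_T(u,v)=(v,\,v\triangleright u)$, and let $\alpha:T\to \mathrm{Sym}(S)$ and $\beta:S\to\mathrm{Sym}(T)$ be maps. Write $\alpha_u=\alpha(u)$ and $\beta_a=\beta(a)$ for $u\in T$, $a\in S$. Then the quadruple $(r_S,r_T,\alpha,\beta)$ is a matched product system of solutions if and only if all the maps $\alpha_u$ ($u\in T$) and $\beta_a$ ($a\in S$) are homomorphisms of left shelves and, for all $a,b\in S$ and $u,v\in T$, $$\alpha_{v\triangleright u}=\alpha_v^{-1}\alpha_u\alpha_v,\qquad \beta_{b\triangleright a}=\beta_b^{-1}\beta_a\beta_b,\qquad \alpha_u=\alpha_{\beta_a^{-1}(u)},\qquad \beta_a=\beta_{\alpha_u^{-1}(a)}.$$ In particular, when $(r_S,r_T,\alpha,\beta)$ is a matched product system of solutions, the matched product solution $r_S\bowtie r_T$ on $S\times T$ is given by $$(r_S\bowtie r_T)\big((a,u),(b,v)\big)=\Big(\big(\alpha_u(b),\,\beta_a(v)\big),\ \big(\alpha_v^{-1}(\alpha_u(b)\triangleright a),\ \beta_b^{-1}(\beta_a(v)\triangleright u)\big)\Big)$$ for all $a,b\in S$, $u,v\in T$, and $r_S\bowtie r_T$ is left non-degenerate.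
   Context: Solutions. A (set-theoretical) solution on a set $X$ is a map $r:X\times X\to X\times X$ with $(r\times\mathrm{id}_X)(\mathrm{id}_X\times r)(r\times\mathrm{id}_X)=(\mathrm{id}_X\times r)(r\times\mathrm{id}_X)(\mathrm{id}_X\times r)$. Write $r(x,y)=(\lambda_x(y),\rho_y(x))$. The solution $r$ is left non-degenerate if every $\lambda_x$ is bijective. Left shelves. A left shelf is a set $X$ with a binary operation $\triangleright$ such that $x\triangleright(y\triangleright z)=(x\triangleright y)\triangleright(x\triangleright z)$ for all $x,y,z\in X$. The solution associated with it is $r_\triangleright(x,y)=(y,\,y\triangleright x)$. A homomorphism of left shelves is a map $f$ with $f(x\triangleright y)=f(x)\triangleright f(y)$. $\mathrm{Sym}(X)$ is the group of bijections $X\to X$; juxtaposition of maps is composition, $fg=f\circ g$. Matched product systems. Given solutions $r_S$ on $S$ and $r_T$ on $T$ (components of both written $\lambda,\rho$, with $a,b\in S$ and $u,v\in T$) and maps $\alpha:T\to\mathrm{Sym}(S)$, $\beta:S\to\mathrm{Sym}(T)$, with $\alpha_u:=\alpha(u)$, $\beta_a:=\beta(a)$, the quadruple $(r_S,r_T,\alpha,\beta)$ is a matched product system of solutions if for all $a,b\in S$, $u,v\in T$: (s1) $\alpha_u\alpha_v=\alpha_{\lambda_u(v)}\alpha_{\rho_v(u)}$; (s2) $\beta_a\beta_b=\beta_{\lambda_a(b)}\beta_{\rho_b(a)}$; (s3) $\rho_{\alpha_u^{-1}(b)}\big(\alpha^{-1}_{\beta_a(u)}(a)\big)=\alpha^{-1}_{\beta_{\rho_b(a)}\beta_b^{-1}(u)}\big(\rho_b(a)\big)$;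 (s4) $\rho_{\beta_a^{-1}(v)}\big(\beta^{-1}_{\alpha_u(a)}(u)\big)=\beta^{-1}_{\alpha_{\rho_v(u)}\alpha_v^{-1}(a)}\big(\rho_v(u)\big)$; (s5) $\lambda_a\alpha_{\beta_a^{-1}(u)}=\alpha_u\lambda_{\alpha_u^{-1}(a)}$; (s6) $\lambda_u\beta_{\alpha_u^{-1}(a)}=\beta_a\lambda_{\beta_a^{-1}(u)}$. Matched product. For a matched product system, the matched product solution $r_S\bowtie r_T$ is the map on $(S\times T)\times(S\times T)$ (known to be a solution on $S\times T$) $$\big((a,u),(b,v)\big)\mapsto\Big(\big(A,U\big),\ \big(\alpha^{-1}_{\overline U}(\rho_{\alpha_{\bar u}(b)}(a)),\ \beta^{-1}_{\overline A}(\rho_{\beta_{\bar a}(v)}(u))\big)\Big),$$ where $\bar a=\alpha_u^{-1}(a)$, $\bar u=\beta_a^{-1}(u)$, $A=\alpha_u(\lambda_{\bar a}(b))$, $U=\beta_a(\lambda_{\bar u}(v))$, $\overline A=\alpha_U^{-1}(A)$, $\overline U=\beta_A^{-1}(U)$. *)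

theory Defs
  imports "HOL-Algebra.Bij"
begin

text \<open>
  Sets are carriers (possibly empty). Functions on them are total at the type level, so only
  their values on the carriers matter. The library group \<^term>\<open>BijGroup X\<close> plays the role
  of \<open>Sym(X)\<close>; its elements are extensional functions, so equality there is equality of
  maps on \<open>X\<close>.
\<close>

abbreviation Sym :: "'a set \<Rightarrow> ('a \<Rightarrow> 'a) monoid" where
  "Sym X \<equiv> BijGroup X"


definition map12 :: "('a \<times> 'a \<Rightarrow> 'a \<times> 'a) \<Rightarrow> 'a \<times> 'a \<times> 'a \<Rightarrow> 'a \<times> 'a \<times> 'a" where
  "map12 r = (\<lambda>(x, y, z). (fst (r (x, y)), snd (r (x, y)), z))"

definition map23 :: "('a \<times> 'a \<Rightarrow> 'a \<times> 'a) \<Rightarrow> 'a \<times> 'a \<times> 'a \<Rightarrow> 'a \<times> 'a \<times> 'a" where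
  "map23 r = (\<lambda>(x, y, z). (x, r (y, z)))"

locale solution =
  fixes X :: "'a set" and r :: "'a \<times> 'a \<Rightarrow> 'a \<times> 'a"
  assumes closed: "r \<in> X \<times> X \<rightarrow> X \<times> X"
    and braid: "\<And>t. t \<in> X \<times> X \<times> X \<Longrightarrow>
      (map12 r \<circ> map23 r \<circ> map12 r) t = (map23 r \<circ> map12 r \<circ> map23 r) t"

text \<open>Components of \<open>r (x, y) = (lam r x y, rho r y x)\<close>; note the argument order of \<open>rho\<close>.\<close>

definition lam :: "('a \<times> 'a \<Rightarrow> 'a \<times> 'a) \<Rightarrow> 'a \<Rightarrow> 'a \<Rightarrow> 'a" where
  "lam r x y = fst (r (x, y))"

definition rho :: "('a \<times> 'a \<Rightarrow> 'a \<times> 'a) \<Rightarrow> 'a \<Rightarrow> 'a \<Rightarrow> 'a" where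
  "rho r y x = snd (r (x, y))"

definition left_nondegenerate :: "'a set \<Rightarrow> ('a \<times> 'a \<Rightarrow> 'a \<times> 'a) \<Rightarrow> bool" where
  "left_nondegenerate X r \<longleftrightarrow> (\<forall>x\<in>X. bij_betw (lam r x) X X)"


locale left_shelf =
  fixes X :: "'a set" and shelf_op :: "'a \<Rightarrow> 'a \<Rightarrow> 'a" (infixr \<open>\<triangleright>\<close> 70)
  assumes closed: "\<And>x y. x \<in> X \<Longrightarrow> y \<in> X \<Longrightarrow> x \<triangleright> y \<in> X"
    and self_distrib: "\<And>x y z. x \<in> X \<Longrightarrow> y \<in> X \<Longrightarrow> z \<in> X \<Longrightarrow>
      x \<triangleright> (y \<triangleright> z) = (x \<triangleright> y) \<triangleright> (x \<triangleright> z)"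

definition shelf_hom ::
  "'a set \<Rightarrow> ('a \<Rightarrow> 'a \<Rightarrow> 'a) \<Rightarrow> 'b set \<Rightarrow> ('b \<Rightarrow> 'b \<Rightarrow> 'b) \<Rightarrow> ('a \<Rightarrow> 'b) \<Rightarrow> bool" where
  "shelf_hom X opX Y opY f \<longleftrightarrow>
     f \<in> X \<rightarrow> Y \<and> (\<forall>x\<in>X. \<forall>y\<in>X. f (opX x y) = opY (f x) (f y))"

definition shelf_solution :: "('a \<Rightarrow> 'a \<Rightarrow> 'a) \<Rightarrow> 'a \<times> 'a \<Rightarrow> 'a \<times> 'a" where
  "shelf_solution opX = (\<lambda>(x, y). (y, opX y x))"


text \<open>
  In \<open>s5\<close> and \<open>s6\<close> the maps \<open>lam r a\<close> need not be bijective, so the products are compositions of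
  maps on the carrier (\<^const>\<open>compose\<close>) rather than products in \<open>Sym\<close>.
\<close>

locale matched_product_system =
  S: solution S rS + T: solution T rT
  for S :: "'a set" and rS :: "'a \<times> 'a \<Rightarrow> 'a \<times> 'a"
    and T :: "'b set" and rT :: "'b \<times> 'b \<Rightarrow> 'b \<times> 'b" +
  fixes \<alpha> :: "'b \<Rightarrow> 'a \<Rightarrow> 'a" and \<beta> :: "'a \<Rightarrow> 'b \<Rightarrow> 'b"
  assumes alpha_Sym: "\<alpha> \<in> T \<rightarrow> carrier (Sym S)"
    and beta_Sym: "\<beta> \<in> S \<rightarrow> carrier (Sym T)"
    and s1: "\<And>u v. u \<in> T \<Longrightarrow> v \<in> T \<Longrightarrow>
      \<alpha> u \<otimes>\<^bsub>Sym S\<^esub> \<alpha> v = \<alpha> (lam rT u v) \<otimes>\<^bsub>Sym S\<^esub> \<alpha> (rho rT v u)"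
    and s2: "\<And>a b. a \<in> S \<Longrightarrow> b \<in> S \<Longrightarrow>
      \<beta> a \<otimes>\<^bsub>Sym T\<^esub> \<beta> b = \<beta> (lam rS a b) \<otimes>\<^bsub>Sym T\<^esub> \<beta> (rho rS b a)"
    and s3: "\<And>a b u. a \<in> S \<Longrightarrow> b \<in> S \<Longrightarrow> u \<in> T \<Longrightarrow>
      rho rS ((inv\<^bsub>Sym S\<^esub> (\<alpha> u)) b) ((inv\<^bsub>Sym S\<^esub> (\<alpha> (\<beta> a u))) a) =
      (inv\<^bsub>Sym S\<^esub> (\<alpha> (\<beta> (rho rS b a) ((inv\<^bsub>Sym T\<^esub> (\<beta> b)) u)))) (rho rS b a)"
    and s4: "\<And>a u v. a \<in> S \<Longrightarrow> u \<in> T \<Longrightarrow> v \<in> T \<Longrightarrow>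
      rho rT ((inv\<^bsub>Sym T\<^esub> (\<beta> a)) v) ((inv\<^bsub>Sym T\<^esub> (\<beta> (\<alpha> u a))) u) =
      (inv\<^bsub>Sym T\<^esub> (\<beta> (\<alpha> (rho rT v u) ((inv\<^bsub>Sym S\<^esub> (\<alpha> v)) a)))) (rho rT v u)"
    and s5: "\<And>a u. a \<in> S \<Longrightarrow> u \<in> T \<Longrightarrow>
      compose S (lam rS a) (\<alpha> ((inv\<^bsub>Sym T\<^esub> (\<beta> a)) u)) =
      compose S (\<alpha> u) (lam rS ((inv\<^bsub>Sym S\<^esub> (\<alpha> u)) a))"
    and s6: "\<And>a u. a \<in> S \<Longrightarrow> u \<in> T \<Longrightarrow>
      compose T (lam rT u) (\<beta> ((inv\<^bsub>Sym S\<^esub> (\<alpha> u)) a)) =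
      compose T (\<beta> a) (lam rT ((inv\<^bsub>Sym T\<^esub> (\<beta> a)) u))"

definition matched_product ::
  "'a set \<Rightarrow> ('a \<times> 'a \<Rightarrow> 'a \<times> 'a) \<Rightarrow> 'b set \<Rightarrow> ('b \<times> 'b \<Rightarrow> 'b \<times> 'b) \<Rightarrow>
   ('b \<Rightarrow> 'a \<Rightarrow> 'a) \<Rightarrow> ('a \<Rightarrow> 'b \<Rightarrow> 'b) \<Rightarrow>
   ('a \<times> 'b) \<times> ('a \<times> 'b) \<Rightarrow> ('a \<times> 'b) \<times> ('a \<times> 'b)" where
  "matched_product S rS T rT \<alpha> \<beta> = (\<lambda>((a, u), (b, v)).
     let a' = (inv\<^bsub>Sym S\<^esub> (\<alpha> u)) a;
         u' = (inv\<^bsub>Sym T\<^esub> (\<beta> a)) u;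
         A = \<alpha> u (lam rS a' b);
         U = \<beta> a (lam rT u' v);
         A' = (inv\<^bsub>Sym S\<^esub> (\<alpha> U)) A;
         U' = (inv\<^bsub>Sym T\<^esub> (\<beta> A)) U
     in ((A, U),
         ((inv\<^bsub>Sym S\<^esub> (\<alpha> U')) (rho rS (\<alpha> u' b) a),
          (inv\<^bsub>Sym T\<^esub> (\<beta> A')) (rho rT (\<beta> a' v) u))))"

end

theory Submission
  imports Defs
begin

text \<open>
  For the solution of a left shelf every \<open>\<lambda>\<^sub>x\<close> is the identity and \<open>\<rho>\<^sub>y\<close> is left multiplication
  by \<open>y\<close>. This makes the six axioms fall apart into simple conditions. With the \<open>\<lambda>\<close>s erased, (s5)
  and (s6) say that \<open>\<alpha>\<close> is constant along the action of all \<open>\<beta>\<^sub>a\<close> and \<open>\<beta>\<close> along the action of all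
  \<open>\<alpha>\<^sub>u\<close>. Likewise (s1) reads \<open>\<alpha>\<^sub>u \<alpha>\<^sub>v = \<alpha>\<^sub>v \<alpha>\<^bsub>v \<triangleright> u\<^esub>\<close>, which is the conjugation formula after
  cancelling \<open>\<alpha>\<^sub>v\<close> (\<open>commute_past_iff_conjugate\<close>), and (s2) is its mirror image.

  The only interplay between axioms is in (s3) and (s4): once \<open>\<alpha>\<close> is invariant under \<open>\<beta>\<close>, all the
  maps \<open>\<alpha>\<^bsub>\<beta>\<dots>(u)\<^esub>\<close> occurring in (s3) collapse to \<open>\<alpha>\<^sub>u\<close>, and (s3) becomes
  \<open>\<alpha>\<^sub>u\<^sup>-\<^sup>1(b) \<triangleright> \<alpha>\<^sub>u\<^sup>-\<^sup>1(a) = \<alpha>\<^sub>u\<^sup>-\<^sup>1(b \<triangleright> a)\<close>, that is, \<open>\<alpha>\<^sub>u\<^sup>-\<^sup>1\<close> and hence \<open>\<alpha>\<^sub>u\<close> preserves the operation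
  (\<open>shelf_hom_iff_inv_preserves\<close>, \<open>s3_iff_hom\<close>).

  The same collapse of indices simplifies the matched product. Its \<open>\<lambda>\<close>-component at \<open>(a, u)\<close> is then
  \<open>\<alpha>\<^sub>u \<times> \<beta>\<^sub>a\<close>, a product of bijections.
\<close>

section \<open>Solutions of left shelves\<close>

lemma lam_shelf_solution [simp]: "lam (shelf_solution opX) x y = y"
  by (simp add: lam_def shelf_solution_def)

lemma rho_shelf_solution [simp]: "rho (shelf_solution opX) y x = opX y x"
  by (simp add: rho_def shelf_solution_def)

text \<open>
  Both sides of the braid relation send \<open>(x, y, z)\<close> to a triple starting with \<open>z, z \<triangleright> y\<close>; the last
  entries are the two sides of self-distributivity.
\<close>

lemma (in left_shelf) solution_shelf_solution: "solution X (shelf_solution (\<triangleright>))"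
proof
  fix t assume "t \<in> X \<times> X \<times> X"
  then obtain x y z where t: "t = (x, y, z)" and xyz: "x \<in> X" "y \<in> X" "z \<in> X" by blast
  show "(map12 (shelf_solution (\<triangleright>)) \<circ> map23 (shelf_solution (\<triangleright>)) \<circ>
      map12 (shelf_solution (\<triangleright>))) t =
    (map23 (shelf_solution (\<triangleright>)) \<circ> map12 (shelf_solution (\<triangleright>)) \<circ>
      map23 (shelf_solution (\<triangleright>))) t"
    using self_distrib[OF xyz(3,2,1)] by (simp add: t shelf_solution_def map12_def map23_def)
qed (auto simp: shelf_solution_def closed)

section \<open>Permutations of a carrier\<close>

lemma Sym_bij: "f \<in> carrier (Sym X) \<Longrightarrow> bij_betw f X X"
  by (simp add: BijGroup_def Bij_def)

lemma Sym_mem: "f \<in> carrier (Sym X) \<Longrightarrow> x \<in> X \<Longrightarrow> f x \<in> X"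
  using Sym_bij bij_betwE by blast

lemma Sym_inv_closed: "f \<in> carrier (Sym X) \<Longrightarrow> inv\<^bsub>Sym X\<^esub> f \<in> carrier (Sym X)"
  by (simp add: group.inv_closed[OF group_BijGroup])

lemma Sym_inv_apply:
  assumes "f \<in> carrier (Sym X)" "x \<in> X"
  shows "(inv\<^bsub>Sym X\<^esub> f) x = inv_into X f x"
proof -
  have "f \<in> Bij X" using assms(1) by (simp add: BijGroup_def)
  then show ?thesis using assms(2) by (simp add: inv_BijGroup)
qed

lemma Sym_inv_left:
  assumes "f \<in> carrier (Sym X)" "x \<in> X"
  shows "(inv\<^bsub>Sym X\<^esub> f) (f x) = x"
  using assms Sym_mem[OF assms] Sym_bij[OF assms(1)]
  by (simp add: Sym_inv_apply bij_betw_inv_into_left)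

lemma Sym_inv_right:
  assumes "f \<in> carrier (Sym X)" "x \<in> X"
  shows "f ((inv\<^bsub>Sym X\<^esub> f) x) = x"
  using assms Sym_bij[OF assms(1)]
  by (simp add: Sym_inv_apply bij_betw_inv_into_right)

lemmas Sym_simps = Sym_mem Sym_inv_closed Sym_inv_left Sym_inv_right

text \<open>The form that (s5) and (s6) take for shelf solutions: with identities in place of the
  \<open>\<lambda>\<close>s, only an equality in the symmetric group remains.\<close>

lemma compose_lam_shelf_solution_iff:
  assumes "f \<in> carrier (Sym X)" "g \<in> carrier (Sym X)"
  shows "compose X (lam (shelf_solution opX) x) f = compose X g (lam (shelf_solution opX) y)
    \<longleftrightarrow> f = g"
proof -
  have "compose X (lam (shelf_solution opX) x) f = f"
    "compose X g (lam (shelf_solution opX) y) = g"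
    using assms by (auto simp: compose_def BijGroup_def Bij_def extensional_restrict)
  then show ?thesis by simp
qed

lemma shelf_hom_iff_inv_preserves:
  assumes "left_shelf X opX" "f \<in> carrier (Sym X)"
  shows "shelf_hom X opX X opX f \<longleftrightarrow>
    (\<forall>a\<in>X. \<forall>b\<in>X. opX ((inv\<^bsub>Sym X\<^esub> f) b) ((inv\<^bsub>Sym X\<^esub> f) a) = (inv\<^bsub>Sym X\<^esub> f) (opX b a))"
    (is "_ \<longleftrightarrow> ?R")
proof -
  interpret left_shelf X opX by fact
  note [simp] = Sym_simps[OF assms(2)] Sym_mem[OF Sym_inv_closed[OF assms(2)]] closed
  show ?thesis
  proof
    assume h: "shelf_hom X opX X opX f"
    show ?R
    proof (intro ballI)
      fix a b assume ab: "a \<in> X" "b \<in> X"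
      let ?g = "inv\<^bsub>Sym X\<^esub> f"
      have "f (opX (?g b) (?g a)) = opX b a"
        using h ab by (simp add: shelf_hom_def)
      then show "opX (?g b) (?g a) = ?g (opX b a)"
        using ab by (metis Sym_inv_left[OF assms(2)] Sym_mem[OF Sym_inv_closed[OF assms(2)]] closed)
    qed
  next
    assume R: ?R
    have "f (opX x y) = opX (f x) (f y)" if "x \<in> X" "y \<in> X" for x y
    proof -
      have "opX x y = (inv\<^bsub>Sym X\<^esub> f) (opX (f x) (f y))"
        using R[rule_format, of "f y" "f x"] that by simp
      then show ?thesis using that by simp
    qed
    then show "shelf_hom X opX X opX f" by (auto simp: shelf_hom_def)
  qed
qed

lemma (in group) commute_past_iff_conjugate:
  assumes "x \<in> carrier G" "y \<in> carrier G" "z \<in> carrier G"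
  shows "x \<otimes> y = y \<otimes> z \<longleftrightarrow> z = inv y \<otimes> x \<otimes> y"
  using assms by (simp add: m_assoc inv_solve_left)

section \<open>The axioms for a pair of left shelves\<close>

text \<open>
  The hypotheses are invariant under exchanging the two sides, so each fact about \<open>\<alpha>\<close> proved here
  also gives the corresponding fact about \<open>\<beta>\<close>.
\<close>

locale mutual_permutation_families =
  fixes S :: "'a set" and T :: "'b set" and \<alpha> :: "'b \<Rightarrow> 'a \<Rightarrow> 'a" and \<beta> :: "'a \<Rightarrow> 'b \<Rightarrow> 'b"
  assumes alpha: "\<alpha> \<in> T \<rightarrow> carrier (Sym S)" and beta: "\<beta> \<in> S \<rightarrow> carrier (Sym T)"
begin

lemma alpha_carrier: "u \<in> T \<Longrightarrow> \<alpha> u \<in> carrier (Sym S)"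
  using alpha by blast

lemma beta_carrier: "a \<in> S \<Longrightarrow> \<beta> a \<in> carrier (Sym T)"
  using beta by blast

lemmas alpha_simps = Sym_simps[OF alpha_carrier] Sym_mem[OF Sym_inv_closed[OF alpha_carrier]]
lemmas beta_simps = Sym_simps[OF beta_carrier] Sym_mem[OF Sym_inv_closed[OF beta_carrier]]

definition alpha_invariant :: bool where
  "alpha_invariant \<longleftrightarrow> (\<forall>a\<in>S. \<forall>u\<in>T. \<alpha> u = \<alpha> ((inv\<^bsub>Sym T\<^esub> (\<beta> a)) u))"

lemma alpha_inv_beta:
  "alpha_invariant \<Longrightarrow> a \<in> S \<Longrightarrow> u \<in> T \<Longrightarrow> \<alpha> ((inv\<^bsub>Sym T\<^esub> (\<beta> a)) u) = \<alpha> u"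
  by (simp add: alpha_invariant_def)

lemma alpha_beta:
  assumes "alpha_invariant" "a \<in> S" "u \<in> T"
  shows "\<alpha> (\<beta> a u) = \<alpha> u"
  using alpha_inv_beta[OF assms(1,2), of "\<beta> a u"] assms by (simp add: beta_simps)

lemma s1_iff_conjugation:
  assumes "left_shelf T opT"
  shows "(\<forall>u\<in>T. \<forall>v\<in>T. \<alpha> u \<otimes>\<^bsub>Sym S\<^esub> \<alpha> v =
      \<alpha> (lam (shelf_solution opT) u v) \<otimes>\<^bsub>Sym S\<^esub> \<alpha> (rho (shelf_solution opT) v u)) \<longleftrightarrow>
    (\<forall>u\<in>T. \<forall>v\<in>T. \<alpha> (opT v u) = inv\<^bsub>Sym S\<^esub> (\<alpha> v) \<otimes>\<^bsub>Sym S\<^esub> \<alpha> u \<otimes>\<^bsub>Sym S\<^esub> \<alpha> v)"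
  using left_shelf.closed[OF assms]
  by (simp add: group.commute_past_iff_conjugate[OF group_BijGroup] alpha_carrier)

lemma s5_iff_invariant:
  "(\<forall>a\<in>S. \<forall>u\<in>T.
      compose S (lam (shelf_solution opS) a) (\<alpha> ((inv\<^bsub>Sym T\<^esub> (\<beta> a)) u)) =
      compose S (\<alpha> u) (lam (shelf_solution opS) ((inv\<^bsub>Sym S\<^esub> (\<alpha> u)) a))) \<longleftrightarrow>
    alpha_invariant"
  by (auto simp: compose_lam_shelf_solution_iff alpha_carrier beta_simps alpha_invariant_def)

text \<open>Under invariance every \<open>\<alpha>\<close> occurring in (s3) is \<open>\<alpha>\<^sub>u\<close>.\<close>

lemma s3_iff_hom:
  assumes "left_shelf S opS" "alpha_invariant"
  shows "(\<forall>a\<in>S. \<forall>b\<in>S. \<forall>u\<in>T.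
      rho (shelf_solution opS) ((inv\<^bsub>Sym S\<^esub> (\<alpha> u)) b) ((inv\<^bsub>Sym S\<^esub> (\<alpha> (\<beta> a u))) a) =
      (inv\<^bsub>Sym S\<^esub> (\<alpha> (\<beta> (rho (shelf_solution opS) b a) ((inv\<^bsub>Sym T\<^esub> (\<beta> b)) u))))
        (rho (shelf_solution opS) b a)) \<longleftrightarrow>
    (\<forall>u\<in>T. shelf_hom S opS S opS (\<alpha> u))"
proof -
  have "shelf_hom S opS S opS (\<alpha> u) \<longleftrightarrow> (\<forall>a\<in>S. \<forall>b\<in>S.
      opS ((inv\<^bsub>Sym S\<^esub> (\<alpha> u)) b) ((inv\<^bsub>Sym S\<^esub> (\<alpha> u)) a) = (inv\<^bsub>Sym S\<^esub> (\<alpha> u)) (opS b a))"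
    if "u \<in> T" for u
    using shelf_hom_iff_inv_preserves[OF assms(1)] alpha_carrier that by blast
  then show ?thesis
    using left_shelf.closed[OF assms(1)]
    by (auto simp: alpha_beta[OF assms(2)] alpha_inv_beta[OF assms(2)] beta_simps)
qed

end

section \<open>The matched product\<close>

text \<open>
  The outermost permutations in the second component are the inverses of \<open>\<alpha>\<close> and \<open>\<beta>\<close> at long
  expressions obtained from \<open>v\<close> and \<open>b\<close> by acting with \<open>\<beta>\<close>s and \<open>\<alpha>\<close>s. Invariance strips these
  actions, and likewise the ones on \<open>u\<close> and \<open>a\<close> inside the arguments of the two operations.
\<close>

lemma matched_product_shelf_solution:
  assumes "mutual_permutation_families S T \<alpha> \<beta>"
    and "mutual_permutation_families.alpha_invariant S T \<alpha> \<beta>"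
    and "mutual_permutation_families.alpha_invariant T S \<beta> \<alpha>"
    and "a \<in> S" "b \<in> S" "u \<in> T" "v \<in> T"
  shows "matched_product S (shelf_solution opS) T (shelf_solution opT) \<alpha> \<beta> ((a, u), (b, v)) =
    ((\<alpha> u b, \<beta> a v),
     ((inv\<^bsub>Sym S\<^esub> (\<alpha> v)) (opS (\<alpha> u b) a), (inv\<^bsub>Sym T\<^esub> (\<beta> b)) (opT (\<beta> a v) u)))"
proof -
  interpret A: mutual_permutation_families S T \<alpha> \<beta> by fact
  interpret B: mutual_permutation_families T S \<beta> \<alpha> by unfold_locales (fact A.beta A.alpha)+
  show ?thesis
    using assms(4-)
    by (simp add: matched_product_def Let_def A.alpha_simps A.beta_simps
        A.alpha_inv_beta[OF assms(2)] A.alpha_beta[OF assms(2)]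
        B.alpha_inv_beta[OF assms(3)] B.alpha_beta[OF assms(3)])
qed

theorem theorem1:
  fixes S :: "'a set" and shS :: "'a \<Rightarrow> 'a \<Rightarrow> 'a" (infixr \<open>\<triangleright>\<^sub>S\<close> 70)
    and T :: "'b set" and shT :: "'b \<Rightarrow> 'b \<Rightarrow> 'b" (infixr \<open>\<triangleright>\<^sub>T\<close> 70)
    and \<alpha> :: "'b \<Rightarrow> 'a \<Rightarrow> 'a" and \<beta> :: "'a \<Rightarrow> 'b \<Rightarrow> 'b"
  assumes "left_shelf S (\<triangleright>\<^sub>S)" and "left_shelf T (\<triangleright>\<^sub>T)"
    and "\<alpha> \<in> T \<rightarrow> carrier (Sym S)" and "\<beta> \<in> S \<rightarrow> carrier (Sym T)"
  shows
    "(matched_product_system S (shelf_solution (\<triangleright>\<^sub>S)) T (shelf_solution (\<triangleright>\<^sub>T)) \<alpha> \<beta> \<longleftrightarrow>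
        (\<forall>u\<in>T. shelf_hom S (\<triangleright>\<^sub>S) S (\<triangleright>\<^sub>S) (\<alpha> u)) \<and>
        (\<forall>a\<in>S. shelf_hom T (\<triangleright>\<^sub>T) T (\<triangleright>\<^sub>T) (\<beta> a)) \<and>
        (\<forall>u\<in>T. \<forall>v\<in>T. \<alpha> (v \<triangleright>\<^sub>T u) = inv\<^bsub>Sym S\<^esub> (\<alpha> v) \<otimes>\<^bsub>Sym S\<^esub> \<alpha> u \<otimes>\<^bsub>Sym S\<^esub> \<alpha> v) \<and>
        (\<forall>a\<in>S. \<forall>b\<in>S. \<beta> (b \<triangleright>\<^sub>S a) = inv\<^bsub>Sym T\<^esub> (\<beta> b) \<otimes>\<^bsub>Sym T\<^esub> \<beta> a \<otimes>\<^bsub>Sym T\<^esub> \<beta> b) \<and>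
        (\<forall>a\<in>S. \<forall>u\<in>T. \<alpha> u = \<alpha> ((inv\<^bsub>Sym T\<^esub> (\<beta> a)) u)) \<and>
        (\<forall>a\<in>S. \<forall>u\<in>T. \<beta> a = \<beta> ((inv\<^bsub>Sym S\<^esub> (\<alpha> u)) a))) \<and>
     (matched_product_system S (shelf_solution (\<triangleright>\<^sub>S)) T (shelf_solution (\<triangleright>\<^sub>T)) \<alpha> \<beta> \<longrightarrow>
        (\<forall>a\<in>S. \<forall>b\<in>S. \<forall>u\<in>T. \<forall>v\<in>T.
           matched_product S (shelf_solution (\<triangleright>\<^sub>S)) T (shelf_solution (\<triangleright>\<^sub>T)) \<alpha> \<beta> ((a, u), (b, v)) =
             ((\<alpha> u b, \<beta> a v),
              ((inv\<^bsub>Sym S\<^esub> (\<alpha> v)) (\<alpha> u b \<triangleright>\<^sub>S a),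
               (inv\<^bsub>Sym T\<^esub> (\<beta> b)) (\<beta> a v \<triangleright>\<^sub>T u)))) \<and>
        left_nondegenerate (S \<times> T)
          (matched_product S (shelf_solution (\<triangleright>\<^sub>S)) T (shelf_solution (\<triangleright>\<^sub>T)) \<alpha> \<beta>))"
proof -
  interpret A: mutual_permutation_families S T \<alpha> \<beta>
    using assms(3,4) by unfold_locales
  interpret B: mutual_permutation_families T S \<beta> \<alpha>
    using assms(3,4) by unfold_locales
  let ?rS = "shelf_solution (\<triangleright>\<^sub>S)" and ?rT = "shelf_solution (\<triangleright>\<^sub>T)"
  let ?M = "matched_product_system S ?rS T ?rT \<alpha> \<beta>"
  note solutions = left_shelf.solution_shelf_solution[OF assms(1)]
    left_shelf.solution_shelf_solution[OF assms(2)]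
  have inv_A: "A.alpha_invariant" if ?M
    unfolding A.s5_iff_invariant[where opS = "(\<triangleright>\<^sub>S)", symmetric]
    by (intro ballI matched_product_system.s5[OF that])
  have inv_B: "B.alpha_invariant" if ?M
    unfolding B.s5_iff_invariant[where opS = "(\<triangleright>\<^sub>T)", symmetric]
    by (intro ballI matched_product_system.s6[OF that])
  have B_inv: "B.alpha_invariant \<longleftrightarrow> (\<forall>a\<in>S. \<forall>u\<in>T. \<beta> a = \<beta> ((inv\<^bsub>Sym S\<^esub> (\<alpha> u)) a))"
    unfolding B.alpha_invariant_def by blast
  have iff: "?M \<longleftrightarrow>
      (\<forall>u\<in>T. shelf_hom S (\<triangleright>\<^sub>S) S (\<triangleright>\<^sub>S) (\<alpha> u)) \<and>
      (\<forall>a\<in>S. shelf_hom T (\<triangleright>\<^sub>T) T (\<triangleright>\<^sub>T) (\<beta> a)) \<and>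
      (\<forall>u\<in>T. \<forall>v\<in>T. \<alpha> (v \<triangleright>\<^sub>T u) = inv\<^bsub>Sym S\<^esub> (\<alpha> v) \<otimes>\<^bsub>Sym S\<^esub> \<alpha> u \<otimes>\<^bsub>Sym S\<^esub> \<alpha> v) \<and>
      (\<forall>a\<in>S. \<forall>b\<in>S. \<beta> (b \<triangleright>\<^sub>S a) = inv\<^bsub>Sym T\<^esub> (\<beta> b) \<otimes>\<^bsub>Sym T\<^esub> \<beta> a \<otimes>\<^bsub>Sym T\<^esub> \<beta> b) \<and>
      A.alpha_invariant \<and> B.alpha_invariant"
    (is "_ \<longleftrightarrow> ?R")
  proof
    assume M: ?M
    note ax = matched_product_system.s1[OF M] matched_product_system.s2[OF M]
      matched_product_system.s3[OF M] matched_product_system.s4[OF M]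
    show ?R
      unfolding A.s1_iff_conjugation[OF assms(2), symmetric]
        B.s1_iff_conjugation[OF assms(1), symmetric]
        A.s3_iff_hom[OF assms(1) inv_A[OF M], symmetric]
        B.s3_iff_hom[OF assms(2) inv_B[OF M], symmetric]
      by (intro conjI ballI ax inv_A[OF M] inv_B[OF M])
  next
    assume R: ?R
    then have inv: "A.alpha_invariant" "B.alpha_invariant" by blast+
    from R have
      ax1: "\<forall>u\<in>T. \<forall>v\<in>T. \<alpha> u \<otimes>\<^bsub>Sym S\<^esub> \<alpha> v =
        \<alpha> (lam ?rT u v) \<otimes>\<^bsub>Sym S\<^esub> \<alpha> (rho ?rT v u)" and
      ax2: "\<forall>a\<in>S. \<forall>b\<in>S. \<beta> a \<otimes>\<^bsub>Sym T\<^esub> \<beta> b =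
        \<beta> (lam ?rS a b) \<otimes>\<^bsub>Sym T\<^esub> \<beta> (rho ?rS b a)"
      unfolding A.s1_iff_conjugation[OF assms(2)] B.s1_iff_conjugation[OF assms(1)] by blast+
    from R have homs: "\<forall>u\<in>T. shelf_hom S (\<triangleright>\<^sub>S) S (\<triangleright>\<^sub>S) (\<alpha> u)"
      "\<forall>a\<in>S. shelf_hom T (\<triangleright>\<^sub>T) T (\<triangleright>\<^sub>T) (\<beta> a)"
      by blast+
    show ?M
      by (intro matched_product_system.intro matched_product_system_axioms.intro
          solutions assms(3,4))
        (use ax1 in blast,
         use ax2 in blast,
         use homs(1)[folded A.s3_iff_hom[OF assms(1) inv(1)]] in blast,
         use homs(2)[folded B.s3_iff_hom[OF assms(2) inv(2)]] in blast,
         use inv(1)[folded A.s5_iff_invariant[where opS = "(\<triangleright>\<^sub>S)"]] in blast,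
         use inv(2)[folded B.s5_iff_invariant[where opS = "(\<triangleright>\<^sub>T)"]] in blast)
  qed
  have formula: "matched_product S ?rS T ?rT \<alpha> \<beta> ((a, u), (b, v)) =
      ((\<alpha> u b, \<beta> a v),
       ((inv\<^bsub>Sym S\<^esub> (\<alpha> v)) (\<alpha> u b \<triangleright>\<^sub>S a), (inv\<^bsub>Sym T\<^esub> (\<beta> b)) (\<beta> a v \<triangleright>\<^sub>T u)))"
    if ?M "a \<in> S" "b \<in> S" "u \<in> T" "v \<in> T" for a b u v
    using matched_product_shelf_solution[OF A.mutual_permutation_families_axioms
        inv_A[OF that(1)] inv_B[OF that(1)]] that by blast
  have nondegenerate: "left_nondegenerate (S \<times> T) (matched_product S ?rS T ?rT \<alpha> \<beta>)" if M: ?M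
    unfolding left_nondegenerate_def
  proof clarify
    fix a u assume au: "a \<in> S" "u \<in> T"
    have "bij_betw (map_prod (\<alpha> u) (\<beta> a)) (S \<times> T) (S \<times> T)"
      using au by (intro bij_betw_map_prod Sym_bij A.alpha_carrier A.beta_carrier)
    moreover have "lam (matched_product S ?rS T ?rT \<alpha> \<beta>) (a, u) p = map_prod (\<alpha> u) (\<beta> a) p"
      if "p \<in> S \<times> T" for p
      using that au by (auto simp: lam_def formula[OF M])
    ultimately show "bij_betw (lam (matched_product S ?rS T ?rT \<alpha> \<beta>) (a, u)) (S \<times> T) (S \<times> T)"
      using bij_betw_cong by blast
  qed
  show ?thesis
    by (intro conjI impI ballI)
      (fact iff[unfolded B_inv, unfolded A.alpha_invariant_def], rule formula, assumption+,
       rule nondegenerate)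
qed

end
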